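(* Let $\sigma$ be a path whose arc length $l$ is lower bounded by $l_{\mathrm{lb}} \leq l$. Let $\sigma(t_1 = 0) \in X$ and $\sigma(t_2 = l) \in X$ be its start and goal states, with clearances $\delta_1 := \delta(\sigma(0))$ and $\delta_2 := \delta(\sigma(l))$, respectively. Then the reciprocal clearance cost $c(\sigma)$ of the path $\sigma$ is lower bounded by $$c(\sigma) \geq \ln\left( \frac{\left( \delta_1 + \delta_2 + l_{\mathrm{lb}} \right)^2}{4\,\delta_1 \delta_2} \right).$$
   Context: $X$ is a state space, with $\|\mathbf{x} - \mathbf{x}'\|$ (for a norm $\|\cdot\|$) the distance between states $\mathbf{x}, \mathbf{x}'$. $X_{\mathrm{invalid}} \subseteq X$ is the subset of invalid states and $X_{\mathrm{valid}} := X \setminus X_{\mathrm{invalid}}$ is the subset of valid states. A path is a continuous function $\sigma \colon [0,l] \to X_{\mathrm{valid}}$ parameterized by its arc length, where $l < \infty$ is the arc length of the path; $\Sigma$ denotes the set of all valid paths. The clearance of a valid state is the function $\delta \colon X_{\mathrm{valid}} \to (0,\infty)$ given by $\delta(\mathbf{x}) := \min_{\mathbf{x}' \in X_{\mathrm{invalid}}} \|\mathbf{x} - \mathbf{x}'\|$; it is assumed that no state on a path of interest has clearance exactly zero. The reciprocal clearance cost $c \colon \Sigma \to [0,\infty)$ of a path is $c(\sigma) := \int_0^l \frac{1}{\delta(\sigma(t))}\,dt$.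
   Formalization: The lower bound l_lb on the arc length is assumed nonnegative; for very negative l_lb the inequality fails because of the square (e.g. l = 0, δ₁ = δ₂ = 1, l_lb = −100). *)

theory Defs
  imports "HOL-Analysis.Analysis"
begin

(* Supremum of the lengths of inscribed polygons, over all finite partitions
   a = p 0 \<le> ... \<le> p n = b; it is \<infinity> for a non-rectifiable curve. *)
definition arc_length :: "(real \<Rightarrow> 'a::real_normed_vector) \<Rightarrow> real \<Rightarrow> real \<Rightarrow> ereal" where
  "arc_length \<sigma> a b =
     Sup {ereal (\<Sum>i<n. norm (\<sigma> (p (Suc i)) - \<sigma> (p i))) |n p.
            p 0 = a \<and> p n = b \<and> mono_on {..n} p}"

(* Continuous paths [0,l] \<rightarrow> X_valid parameterized by arc length. The case s = 0, t = l
   of the last conjunct says that the total arc length is l. *)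
definition is_path :: "'a::real_normed_vector set \<Rightarrow> real \<Rightarrow> (real \<Rightarrow> 'a) \<Rightarrow> bool" where
  "is_path Xvalid l \<sigma> \<longleftrightarrow>
     0 \<le> l \<and> continuous_on {0..l} \<sigma> \<and> \<sigma> ` {0..l} \<subseteq> Xvalid \<and>
     (\<forall>s t. 0 \<le> s \<and> s \<le> t \<and> t \<le> l \<longrightarrow> arc_length \<sigma> s t = ereal (t - s))"

(* The infimum is the minimum whenever the latter exists; attainment is not required.
   Only meaningful for nonempty Xinvalid. *)
definition clearance :: "'a::real_normed_vector set \<Rightarrow> 'a \<Rightarrow> real" where
  "clearance Xinvalid x = (INF x'\<in>Xinvalid. norm (x - x'))"

(* On a path with everywhere positive clearance the integrand is continuous on {0..l},
   so the default value 0 of a non-existing integral plays no role. *)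
definition reciprocal_clearance_cost ::
    "'a::real_normed_vector set \<Rightarrow> real \<Rightarrow> (real \<Rightarrow> 'a) \<Rightarrow> real" where
  "reciprocal_clearance_cost Xinvalid l \<sigma> = integral {0..l} (\<lambda>t. 1 / clearance Xinvalid (\<sigma> t))"

end

(* The clearance along the path is 1-Lipschitz in arc length, so it is at most both
   \<delta>1 + t and \<delta>2 + (l - t). These two bounds coincide at t = (\<delta>2 + l - \<delta>1)/2, which lies
   in [0,l] by the Lipschitz property. Integrating the reciprocal of the first bound before
   that point and of the second one after it gives ln ((\<delta>1 + \<delta>2 + l)^2 / (4 \<delta>1 \<delta>2)), which
   is monotone in l. *)
theory Submission
  imports Defs
begin

text \<open>Gives access to continuity and the triangle inequality of \<open>infdist\<close>.
  Nonemptiness matters because \<open>infdist\<close> to the empty set is 0 by convention.\<close>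

lemma clearance_eq_infdist:
  assumes "A \<noteq> {}"
  shows "clearance A x = infdist x A"
  using assms by (simp add: clearance_def infdist_def dist_norm)

text \<open>The chord is itself an inscribed polygon, with the single step from \<open>s\<close> to
  \<open>t\<close>, so its length is among those in the supremum.\<close>

lemma norm_diff_le_arc_length:
  assumes "s \<le> t"
  shows "ereal (norm (\<sigma> t - \<sigma> s)) \<le> arc_length \<sigma> s t"
  unfolding arc_length_def
proof (intro Sup_upper CollectI exI conjI)
  let ?p = "\<lambda>i::nat. if i = 0 then s else t"
  show "ereal (norm (\<sigma> t - \<sigma> s)) = ereal (\<Sum>i<1. norm (\<sigma> (?p (Suc i)) - \<sigma> (?p i)))"
    by simp
  show "mono_on {..1} ?p"
    using assms by (auto simp: mono_on_def)
qed auto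

text \<open>The arc-length parametrization enters the proof through this bound only.\<close>

lemma is_path_norm_diff_le:
  assumes "is_path V l \<sigma>" "0 \<le> s" "s \<le> t" "t \<le> l"
  shows "norm (\<sigma> t - \<sigma> s) \<le> t - s"
proof -
  have "arc_length \<sigma> s t = ereal (t - s)"
    using assms by (auto simp: is_path_def)
  then show ?thesis
    using norm_diff_le_arc_length[OF assms(3), of \<sigma>] by simp
qed

text \<open>The distance to a fixed set is 1-Lipschitz in the state, and the state is 1-Lipschitz in
  the arc-length parameter.\<close>

lemma clearance_path_diff_le:
  assumes "is_path V l \<sigma>" "A \<noteq> {}" "0 \<le> s" "s \<le> t" "t \<le> l"
  shows "\<bar>clearance A (\<sigma> t) - clearance A (\<sigma> s)\<bar> \<le> t - s"
proof -
  have "norm (\<sigma> t - \<sigma> s) \<le> t - s"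
    using assms is_path_norm_diff_le by blast
  then show ?thesis
    using infdist_triangle_abs[of "\<sigma> t" A "\<sigma> s"] assms(2)
    by (simp add: clearance_eq_infdist dist_norm)
qed

text \<open>Compare \<open>g\<close> with the derivative of \<open>ln (d + (t - a))\<close>, whose
  argument stays positive on the interval because \<open>0 < d\<close>.\<close>

lemma ln_le_integral_forward:
  fixes g :: "real \<Rightarrow> real"
  assumes "a \<le> b" "0 < d" "g integrable_on {a..b}"
    and le: "\<And>t. t \<in> {a..b} \<Longrightarrow> 1 / (d + (t - a)) \<le> g t"
  shows "ln ((d + (b - a)) / d) \<le> integral {a..b} g"
proof -
  have "((\<lambda>t. 1 / (d + (t - a))) has_integral
      ln (d + (b - a)) - ln (d + (a - a))) {a..b}"
    using assms by (intro fundamental_theorem_of_calculus)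
      (auto intro!: derivative_eq_intros simp flip: has_real_derivative_iff_has_vector_derivative)
  then have "ln (d + (b - a)) - ln (d + (a - a)) \<le> integral {a..b} g"
    using integrable_integral[OF assms(3)] le by (rule has_integral_le)
  then show ?thesis
    using assms(1,2) by (simp add: ln_div)
qed

lemma ln_le_integral_backward:
  fixes g :: "real \<Rightarrow> real"
  assumes "a \<le> b" "0 < d" "g integrable_on {a..b}"
    and le: "\<And>t. t \<in> {a..b} \<Longrightarrow> 1 / (d + (b - t)) \<le> g t"
  shows "ln ((d + (b - a)) / d) \<le> integral {a..b} g"
proof -
  \<comment> \<open>The reflection of t to -t exchanges the two endpoints, which reduces the claim
    to the forward version on \<open>{- b..- a}\<close>.\<close>
  have "ln ((d + (- a - - b)) / d) \<le> integral {- b..- a} (\<lambda>t. g (- t))"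
  proof (rule ln_le_integral_forward)
    fix t assume "t \<in> {- b..- a}"
    then show "1 / (d + (t - - b)) \<le> g (- t)"
      using le[of "- t"] by (simp add: add.commute)
  qed (use assms in auto)
  then show ?thesis
    by simp
qed

theorem theorem1:
  fixes X Xinvalid :: "'a::real_normed_vector set"
    and \<sigma> :: "real \<Rightarrow> 'a"
    and l l_lb \<delta>\<^sub>1 \<delta>\<^sub>2 :: real
  assumes "Xinvalid \<subseteq> X" and "Xinvalid \<noteq> {}"
    and "is_path (X - Xinvalid) l \<sigma>"
    and "\<And>t. t \<in> {0..l} \<Longrightarrow> clearance Xinvalid (\<sigma> t) > 0"
    and "0 \<le> l_lb" and "l_lb \<le> l"
    and "\<delta>\<^sub>1 = clearance Xinvalid (\<sigma> 0)"
    and "\<delta>\<^sub>2 = clearance Xinvalid (\<sigma> l)"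
  shows "reciprocal_clearance_cost Xinvalid l \<sigma> \<ge> ln ((\<delta>\<^sub>1 + \<delta>\<^sub>2 + l_lb)\<^sup>2 / (4 * \<delta>\<^sub>1 * \<delta>\<^sub>2))"
proof -
  define f where "f = (\<lambda>t. clearance Xinvalid (\<sigma> t))"
  define m where "m = (\<delta>\<^sub>2 + l - \<delta>\<^sub>1) / 2"
  have l: "0 \<le> l" and cont: "continuous_on {0..l} \<sigma>"
    using assms(3) by (auto simp: is_path_def)
  have fpos: "f t > 0" if "t \<in> {0..l}" for t
    using assms(4)[OF that] by (simp add: f_def)
  have lip: "\<bar>f t - f s\<bar> \<le> t - s" if "0 \<le> s" "s \<le> t" "t \<le> l" for s t
    using clearance_path_diff_le[OF assms(3,2) that] by (simp add: f_def)
  have ends: "f 0 = \<delta>\<^sub>1" "f l = \<delta>\<^sub>2"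
    using assms by (auto simp: f_def)
  have pos: "\<delta>\<^sub>1 > 0" "\<delta>\<^sub>2 > 0"
    using fpos[of 0] fpos[of l] l ends by auto
  have m: "0 \<le> m" "m \<le> l"
    using lip[of 0 l] l ends by (auto simp: m_def)
  have "continuous_on {0..l} f"
    unfolding f_def clearance_eq_infdist[OF assms(2)] using cont by (intro continuous_intros)
  \<comment> \<open>Positive clearance keeps the reciprocal continuous, so its integral exists and
    can be split at \<open>m\<close>.\<close>
  then have "continuous_on {0..l} (\<lambda>t. 1 / f t)"
    using fpos by (intro continuous_intros) (auto simp: less_imp_neq[symmetric])
  then have int: "(\<lambda>t. 1 / f t) integrable_on {0..l}"
    by (rule integrable_continuous_real)
  have "ln ((\<delta>\<^sub>1 + (m - 0)) / \<delta>\<^sub>1) \<le> integral {0..m} (\<lambda>t. 1 / f t)"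
  proof (rule ln_le_integral_forward)
    fix t assume "t \<in> {0..m}"
    \<comment> \<open>By \<open>lip\<close> from the start, \<open>f t\<close> is at most
      \<open>\<delta>\<^sub>1 + t\<close>; positivity of \<open>f t\<close> lets the reciprocals
      reverse the inequality.\<close>
    then show "1 / (\<delta>\<^sub>1 + (t - 0)) \<le> 1 / f t"
      using m lip[of 0 t] ends fpos[of t] by (intro divide_left_mono) auto
  qed (use m pos integrable_on_subinterval[OF int, of 0 m] in auto)
  moreover have "ln ((\<delta>\<^sub>2 + (l - m)) / \<delta>\<^sub>2) \<le> integral {m..l} (\<lambda>t. 1 / f t)"
  proof (rule ln_le_integral_backward)
    fix t assume "t \<in> {m..l}"
    then show "1 / (\<delta>\<^sub>2 + (l - t)) \<le> 1 / f t"
      using m lip[of t l] ends fpos[of t] by (intro divide_left_mono) auto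
  qed (use m pos integrable_on_subinterval[OF int, of m l] in auto)
  moreover have "integral {0..m} (\<lambda>t. 1 / f t) + integral {m..l} (\<lambda>t. 1 / f t)
      = integral {0..l} (\<lambda>t. 1 / f t)"
    using m int by (rule Henstock_Kurzweil_Integration.integral_combine)
  moreover have "ln ((\<delta>\<^sub>1 + \<delta>\<^sub>2 + l)\<^sup>2 / (4 * \<delta>\<^sub>1 * \<delta>\<^sub>2))
      = ln ((\<delta>\<^sub>1 + (m - 0)) / \<delta>\<^sub>1) + ln ((\<delta>\<^sub>2 + (l - m)) / \<delta>\<^sub>2)"
  proof -
    \<comment> \<open>By the choice of \<open>m\<close>, both \<open>\<delta>\<^sub>1 + m\<close>
      and \<open>\<delta>\<^sub>2 + (l - m)\<close> equal
      \<open>(\<delta>\<^sub>1 + \<delta>\<^sub>2 + l) / 2\<close>. Their product yields the square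
      and the factor 4.\<close>
    have "(\<delta>\<^sub>1 + \<delta>\<^sub>2 + l)\<^sup>2 / (4 * \<delta>\<^sub>1 * \<delta>\<^sub>2)
        = ((\<delta>\<^sub>1 + (m - 0)) / \<delta>\<^sub>1) * ((\<delta>\<^sub>2 + (l - m)) / \<delta>\<^sub>2)"
      using pos by (simp add: m_def field_simps power2_eq_square)
    also have "ln \<dots> = ln ((\<delta>\<^sub>1 + (m - 0)) / \<delta>\<^sub>1) + ln ((\<delta>\<^sub>2 + (l - m)) / \<delta>\<^sub>2)"
      using pos m by (intro ln_mult_pos divide_pos_pos) auto
    finally show ?thesis .
  qed
  \<comment> \<open>Since \<open>0 \<le> l_lb\<close>, the smaller base is positive, so squaring and
    the logarithm both preserve the order.\<close>
  moreover have "ln ((\<delta>\<^sub>1 + \<delta>\<^sub>2 + l_lb)\<^sup>2 / (4 * \<delta>\<^sub>1 * \<delta>\<^sub>2)) \<le> ln ((\<delta>\<^sub>1 + \<delta>\<^sub>2 + l)\<^sup>2 / (4 * \<delta>\<^sub>1 * \<delta>\<^sub>2))"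
    using pos assms(5,6)
    by (intro ln_mono divide_right_mono power_mono divide_pos_pos) auto
  ultimately show ?thesis
    by (simp add: reciprocal_clearance_cost_def f_def)
qed

end
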